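(* Consider the energy-quadratized gradient flow system $\partial_t\Psi=\mathcal{N}(\Psi)\mathcal{B}\Psi$ described in the context, with constant $A$ and energy $\frac12\|\Psi\|_{\mathcal{B}}^2-A$. Let $s\ge 1$ be an integer, let $c_1,\dots,c_s\in(0,1)$ be the Gaussian quadrature nodes on $[0,1]$, i.e. the zeros of the $s$-th shifted Legendre polynomial $\frac{d^s}{dx^s}\big(x^s(x-1)^s\big)$, and let $b_1,\dots,b_s\ge 0$ be the corresponding Gauss-Legendre quadrature weights on $[0,1]$. Let $t_n\in\mathbb{R}$, and let $\Delta t>0$ be an arbitrary time step. Given $\Psi^n$, let $u(t)$ be a collocation polynomial, i.e. a polynomial in $t$ of degree at most $s$ (with coefficients in the space of admissible functions) satisfying $$u(t_n)=\Psi^n,\qquad \dot u(t_n+c_i\Delta t)=\mathcal{N}\big(u(t_n+c_i\Delta t)\big)\,\mathcal{B}\,u(t_n+c_i\Delta t),\quad i=1,\dots,s,$$ and define $\Psi^{n+1}=u(t_n+\Delta t)$. Then this $s$-stage HEQ Gaussian collocation scheme is unconditionally energy stable, i.e. (for every $\Delta t>0$) it satisfies the energy dissipation law $$F^{n+1}-F^n=\Delta t\sum_{i=1}^s b_i\Big(\mathcal{B}u(t_n+c_i\Delta t),\ \mathcal{N}\big(u(t_n+c_i\Delta t)\big)\mathcal{B}u(t_n+c_i\Delta t)\Big)\le 0,$$ where $F^{n}=\frac12\|\Psi^{n}\|_{\mathcal{B}}^2-A$ and $F^{n+1}=\frac12\|\Psi^{n+1}\|_{\mathcal{B}}^2-A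$.
   Context: Let $\Omega$ be the spatial domain, with periodic boundary conditions. For vector-valued functions on $\Omega$ with $\ell$ components, $(\mathbf{f},\mathbf{g})=\sum_{i=1}^{\ell}\int_\Omega f_i g_i\,d\mathbf{x}$ is the $L^2$ inner product and $\|\cdot\|$ the $L^2$ norm. Gradient flow: $\partial_t\Phi=\mathcal{G}\frac{\delta F}{\delta\Phi}$ for $\Phi=(\phi_1,\dots,\phi_m)^T$, where $\mathcal{G}$ is an $m\times m$ linear mobility matrix operator, possibly depending on $\Phi$, that is negative semi-definite, and $F=\frac12(\Phi,\mathcal{L}\Phi)+(f,1)$ with $\mathcal{L}$ a linear, self-adjoint, positive definite operator (independent of $\Phi$) and $f=f(\Phi)$ (or more generally $f=f(\Phi,\nabla\Phi)$) bounded from below. Energy quadratization (EQ) reformulation: with $A$ a constant large enough that $g=\sqrt{2(f+A/|\Omega|)}$ is well defined, introduce the auxiliary variable $q=g$ and $\Psi=(\Phi,q)^T$, which has $m+1$ components. The system becomes $\partial_t\Psi=\mathcal{N}(\Psi)\mathcal{B}\Psi$, where $\mathcal{B}=\mathrm{diag}(\mathcal{L},1)$ and $\mathcal{N}(\Psi)=\mathcal{A}^*\mathcal{G}\mathcal{A}$. Here $\mathcal{A}$ (depending on $\Psi$) is the operator mapping $(\Theta,r)^T$ to $\Theta+r\frac{\partial g}{\partial\Phi}$ when $g=g(\Phi)$, respectively to $\Theta+r\frac{\partial g}{\partial\Phi}-\nabla\cdot\big(r\frac{\partial g}{\partial\nabla\Phi}\big)$ when $g=g(\Phi,\nabla\Phi)$,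 and $\mathcal{A}^*$ is its $L^2$-adjoint, mapping $\Theta$ to $\big(\Theta,\frac{\partial g}{\partial\Phi}\cdot\Theta\big)^T$, respectively $\big(\Theta,\frac{\partial g}{\partial\Phi}\cdot\Theta+\frac{\partial g}{\partial\nabla\Phi}\cdot\nabla\Theta\big)^T$. Consequently, $\mathcal{B}$ is a linear, self-adjoint, positive definite operator independent of $\Psi$ and $t$, and for every $\Psi$ the linear operator $\mathcal{N}(\Psi)$ is negative semi-definite, i.e. $(v,\mathcal{N}(\Psi)v)\le0$ for all $v$ in its domain. The $\mathcal{B}$-norm is $\|\Psi\|_{\mathcal{B}}=\sqrt{(\Psi,\mathcal{B}\Psi)}$. In the time-discrete scheme, $\Psi^n$ denotes the approximation at time $t_n$, and $\Phi$ and $q$ are treated as independent unknowns (so $q=g$ is not required to hold at the discrete level). All functions (including the coefficients of $u$) are real-valued, periodic and assumed to lie in a linear space of functions regular enough that $\mathcal{B}$ and $\mathcal{N}(\Psi)\mathcal{B}$ can be applied to them and all inner products are defined. *)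

theory Defs
  imports "HOL-Analysis.Analysis" "HOL-Computational_Algebra.Polynomial"
begin

section \<open>Functions on a periodic box\<close>

text \<open>
  Functions on the torus are represented as periodic functions on all of \<open>\<real>\<^sup>d\<close>;
  the spatial domain is the box \<open>cbox lo hi\<close>, a period cell.
\<close>

definition periodic :: "real^'d \<Rightarrow> real^'d \<Rightarrow> (real^'d \<Rightarrow> 'b) \<Rightarrow> bool" where
  "periodic lo hi f \<longleftrightarrow> (\<forall>x i. f (x + axis i (hi $ i - lo $ i)) = f x)"

definition l2_inner ::
  "'a::euclidean_space set \<Rightarrow> ('a \<Rightarrow> 'b::euclidean_space) \<Rightarrow> ('a \<Rightarrow> 'b) \<Rightarrow> real" where
  "l2_inner \<Omega> f g = (\<Sum>e\<in>Basis. LINT x:\<Omega>|lebesgue. (f x \<bullet> e) * (g x \<bullet> e))"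

text \<open>
  The integrals of \<^const>\<open>l2_inner\<close> are genuine (a non-integrable function has integral 0 in HOL).
\<close>

definition l2_defined ::
  "'a::euclidean_space set \<Rightarrow> ('a \<Rightarrow> 'b::euclidean_space) \<Rightarrow> ('a \<Rightarrow> 'b) \<Rightarrow> bool" where
  "l2_defined \<Omega> f g \<longleftrightarrow>
     (\<forall>e\<in>Basis. set_integrable lebesgue \<Omega> (\<lambda>x. (f x \<bullet> e) * (g x \<bullet> e)))"

definition linear_space :: "('a \<Rightarrow> 'b::real_vector) set \<Rightarrow> bool" where
  "linear_space S \<longleftrightarrow>
     (\<lambda>x. 0) \<in> S \<and>
     (\<forall>f\<in>S. \<forall>g\<in>S. (\<lambda>x. f x + g x) \<in> S) \<and>
     (\<forall>c. \<forall>f\<in>S. (\<lambda>x. c *\<^sub>R f x) \<in> S)"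

definition linear_operator_on ::
  "('a \<Rightarrow> 'b::real_vector) set \<Rightarrow> (('a \<Rightarrow> 'b) \<Rightarrow> 'a \<Rightarrow> 'c::real_vector) \<Rightarrow> bool" where
  "linear_operator_on S T \<longleftrightarrow>
     (\<forall>f\<in>S. \<forall>g\<in>S. T (\<lambda>x. f x + g x) = (\<lambda>x. T f x + T g x)) \<and>
     (\<forall>c. \<forall>f\<in>S. T (\<lambda>x. c *\<^sub>R f x) = (\<lambda>x. c *\<^sub>R T f x))"

definition self_adjoint_on ::
  "'a::euclidean_space set \<Rightarrow> ('a \<Rightarrow> 'b::euclidean_space) set \<Rightarrow>
   (('a \<Rightarrow> 'b) \<Rightarrow> 'a \<Rightarrow> 'b) \<Rightarrow> bool" where
  "self_adjoint_on \<Omega> S T \<longleftrightarrow>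
     (\<forall>f\<in>S. \<forall>g\<in>S. l2_defined \<Omega> f (T g) \<and> l2_inner \<Omega> f (T g) = l2_inner \<Omega> (T f) g)"

text \<open>Functions vanishing almost everywhere on \<open>\<Omega>\<close> count as zero.\<close>

definition positive_definite_on ::
  "'a::euclidean_space set \<Rightarrow> ('a \<Rightarrow> 'b::euclidean_space) set \<Rightarrow>
   (('a \<Rightarrow> 'b) \<Rightarrow> 'a \<Rightarrow> 'b) \<Rightarrow> bool" where
  "positive_definite_on \<Omega> S T \<longleftrightarrow>
     (\<forall>f\<in>S. \<not> (AE x in lebesgue. x \<in> \<Omega> \<longrightarrow> f x = 0) \<longrightarrow> 0 < l2_inner \<Omega> f (T f))"

definition negative_semidefinite_on ::
  "'a::euclidean_space set \<Rightarrow> ('a \<Rightarrow> 'b::euclidean_space) set \<Rightarrow>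
   (('a \<Rightarrow> 'b) \<Rightarrow> 'a \<Rightarrow> 'b) \<Rightarrow> bool" where
  "negative_semidefinite_on \<Omega> S T \<longleftrightarrow>
     (\<forall>f\<in>S. l2_defined \<Omega> f (T f) \<and> l2_inner \<Omega> f (T f) \<le> 0)"


section \<open>Differential operators\<close>

text \<open>
  The spatial gradient of \<open>\<Phi> :: real^'d \<Rightarrow> real^'m\<close> at \<open>x\<close> is \<open>jacobian \<Phi> (at x) :: real^'d^'m\<close>,
  with entry \<open>$ k $ j\<close> equal to the \<open>j\<close>-th partial derivative of the \<open>k\<close>-th component.
\<close>

definition continuously_differentiable ::
  "('a::euclidean_space \<Rightarrow> 'b::euclidean_space) \<Rightarrow> bool" where
  "continuously_differentiable f \<longleftrightarrow>
     (\<forall>x. f differentiable (at x)) \<and>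
     (\<forall>v. continuous_on UNIV (\<lambda>x. frechet_derivative f (at x) v))"

definition grad :: "('a::euclidean_space \<Rightarrow> real) \<Rightarrow> 'a \<Rightarrow> 'a" where
  "grad h y = (\<Sum>e\<in>Basis. frechet_derivative h (at y) e *\<^sub>R e)"

definition divergence :: "(real^'d \<Rightarrow> real^'d^'m) \<Rightarrow> real^'d \<Rightarrow> real^'m" where
  "divergence M x = (\<chi> k. \<Sum>j\<in>UNIV. frechet_derivative M (at x) (axis j 1) $ k $ j)"


section \<open>Energy quadratization\<close>

text \<open>A scalar density depends either on \<open>\<Phi>\<close> only, or on \<open>\<Phi>\<close> and its spatial gradient.\<close>

datatype ('u, 'z) density = Local "'u \<Rightarrow> real" | Gradient "'u \<Rightarrow> 'z \<Rightarrow> real"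

fun density_val :: "('u, 'z) density \<Rightarrow> 'u \<times> 'z \<Rightarrow> real" where
  "density_val (Local f) (y, z) = f y"
| "density_val (Gradient f) (y, z) = f y z"

definition bounded_from_below :: "('u, 'z) density \<Rightarrow> bool" where
  "bounded_from_below f \<longleftrightarrow> (\<exists>C. \<forall>p. C \<le> density_val f p)"

fun eq_density :: "real \<Rightarrow> real \<Rightarrow> ('u, 'z) density \<Rightarrow> ('u, 'z) density" where
  "eq_density vol A (Local f) = Local (\<lambda>y. sqrt (2 * (f y + A / vol)))"
| "eq_density vol A (Gradient f) = Gradient (\<lambda>y z. sqrt (2 * (f y z + A / vol)))"

text \<open>The constant \<open>A\<close> is large enough that \<open>g\<close> is a well-defined function possessing the
  partial derivatives that enter \<open>\<A>\<close>.\<close>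

definition eq_well_defined ::
  "real \<Rightarrow> real \<Rightarrow> ('u::real_normed_vector, 'z::real_normed_vector) density \<Rightarrow> bool" where
  "eq_well_defined vol A f \<longleftrightarrow>
     (\<forall>p. 0 \<le> density_val f p + A / vol) \<and>
     (\<forall>p. density_val (eq_density vol A f) differentiable (at p))"

text \<open>
  \<open>\<Psi> = (\<Phi>, q)\<close> is a function with values in \<open>real^'m \<times> real\<close>, so \<open>fst \<circ> \<Psi> = \<Phi>\<close> and \<open>snd \<circ> \<Psi> = q\<close>.
\<close>

definition opB ::
  "((real^'d \<Rightarrow> real^'m) \<Rightarrow> real^'d \<Rightarrow> real^'m) \<Rightarrow>
   (real^'d \<Rightarrow> (real^'m) \<times> real) \<Rightarrow> real^'d \<Rightarrow> (real^'m) \<times> real" where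
  "opB L \<Psi> = (\<lambda>x. (L (fst \<circ> \<Psi>) x, snd (\<Psi> x)))"

text \<open>The flux \<open>r \<partial>g/\<partial>\<nabla>\<Phi>\<close>, whose divergence enters \<open>\<A>\<close>.\<close>

definition flux ::
  "(real^'m \<Rightarrow> real^'d^'m \<Rightarrow> real) \<Rightarrow> (real^'d \<Rightarrow> real^'m) \<Rightarrow> (real^'d \<Rightarrow> real) \<Rightarrow>
   real^'d \<Rightarrow> real^'d^'m" where
  "flux g \<Phi> r x = r x *\<^sub>R grad (\<lambda>z. g (\<Phi> x) z) (jacobian \<Phi> (at x))"

fun opA ::
  "(real^'m, real^'d^'m) density \<Rightarrow> (real^'d \<Rightarrow> (real^'m) \<times> real) \<Rightarrow>
   (real^'d \<Rightarrow> (real^'m) \<times> real) \<Rightarrow> real^'d \<Rightarrow> real^'m" where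
  "opA (Local g) \<Psi> v =
     (\<lambda>x. fst (v x) + snd (v x) *\<^sub>R grad g (fst (\<Psi> x)))"
| "opA (Gradient g) \<Psi> v =
     (\<lambda>x. fst (v x)
        + snd (v x) *\<^sub>R grad (\<lambda>y. g y (jacobian (fst \<circ> \<Psi>) (at x))) (fst (\<Psi> x))
        - divergence (flux g (fst \<circ> \<Psi>) (snd \<circ> v)) x)"

text \<open>In the second equation the inner product of the two matrices is the Frobenius one.\<close>

fun opA_adj ::
  "(real^'m, real^'d^'m) density \<Rightarrow> (real^'d \<Rightarrow> (real^'m) \<times> real) \<Rightarrow>
   (real^'d \<Rightarrow> real^'m) \<Rightarrow> real^'d \<Rightarrow> (real^'m) \<times> real" where
  "opA_adj (Local g) \<Psi> \<Theta> =
     (\<lambda>x. (\<Theta> x, grad g (fst (\<Psi> x)) \<bullet> \<Theta> x))"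
| "opA_adj (Gradient g) \<Psi> \<Theta> =
     (\<lambda>x. (\<Theta> x,
        grad (\<lambda>y. g y (jacobian (fst \<circ> \<Psi>) (at x))) (fst (\<Psi> x)) \<bullet> \<Theta> x
        + grad (\<lambda>z. g (fst (\<Psi> x)) z) (jacobian (fst \<circ> \<Psi>) (at x)) \<bullet> jacobian \<Theta> (at x)))"

definition opN ::
  "((real^'d \<Rightarrow> real^'m) \<Rightarrow> (real^'d \<Rightarrow> real^'m) \<Rightarrow> real^'d \<Rightarrow> real^'m) \<Rightarrow>
   (real^'m, real^'d^'m) density \<Rightarrow> (real^'d \<Rightarrow> (real^'m) \<times> real) \<Rightarrow>
   (real^'d \<Rightarrow> (real^'m) \<times> real) \<Rightarrow> real^'d \<Rightarrow> (real^'m) \<times> real" where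
  "opN G g \<Psi> v = opA_adj g \<Psi> (G (fst \<circ> \<Psi>) (opA g \<Psi> v))"

text \<open>
  Regularity under which the formulas for \<open>\<A>(\<Psi>) v\<close> and \<open>\<A>(\<Psi>)\<^sup>* \<Theta>\<close> make sense as classical
  functions on the torus. Nothing is required when \<open>g = g(\<Phi>)\<close>, where both are pointwise.
\<close>

fun regular_for_A ::
  "(real^'m, real^'d^'m) density \<Rightarrow> (real^'d \<Rightarrow> (real^'m) \<times> real) \<Rightarrow>
   (real^'d \<Rightarrow> (real^'m) \<times> real) \<Rightarrow> bool" where
  "regular_for_A (Local g) \<Psi> v \<longleftrightarrow> True"
| "regular_for_A (Gradient g) \<Psi> v \<longleftrightarrow>
     (\<forall>x. (fst \<circ> \<Psi>) differentiable (at x)) \<and>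
     continuously_differentiable (flux g (fst \<circ> \<Psi>) (snd \<circ> v))"

fun regular_for_A_adj ::
  "(real^'m, real^'d^'m) density \<Rightarrow> (real^'d \<Rightarrow> real^'m) \<Rightarrow> bool" where
  "regular_for_A_adj (Local g) \<Theta> \<longleftrightarrow> True"
| "regular_for_A_adj (Gradient g) \<Theta> \<longleftrightarrow> continuously_differentiable \<Theta>"

text \<open>\<open>DG \<Phi>\<close> is the domain of the mobility operator \<open>G \<Phi>\<close>.\<close>

definition domN ::
  "real^'d \<Rightarrow> real^'d \<Rightarrow> ((real^'d \<Rightarrow> real^'m) \<Rightarrow> (real^'d \<Rightarrow> real^'m) set) \<Rightarrow>
   ((real^'d \<Rightarrow> real^'m) \<Rightarrow> (real^'d \<Rightarrow> real^'m) \<Rightarrow> real^'d \<Rightarrow> real^'m) \<Rightarrow>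
   (real^'m, real^'d^'m) density \<Rightarrow> (real^'d \<Rightarrow> (real^'m) \<times> real) \<Rightarrow>
   (real^'d \<Rightarrow> (real^'m) \<times> real) set" where
  "domN lo hi DG G g \<Psi> =
     {v. periodic lo hi v \<and>
         regular_for_A g \<Psi> v \<and>
         opA g \<Psi> v \<in> DG (fst \<circ> \<Psi>) \<and>
         regular_for_A_adj g (G (fst \<circ> \<Psi>) (opA g \<Psi> v)) \<and>
         l2_defined (cbox lo hi) v (opN G g \<Psi> v)}"

text \<open>
  \<open>X\<close> is a linear space of periodic functions to which \<open>\<B>\<close> (with \<open>D\<close> the domain of \<open>L\<close>)
  and \<open>\<N>(\<Psi>)\<B>\<close> can be applied, with all inner products defined.
\<close>

definition admissible_space ::
  "real^'d \<Rightarrow> real^'d \<Rightarrow> (real^'d \<Rightarrow> real^'m) set \<Rightarrow>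
   ((real^'d \<Rightarrow> real^'m) \<Rightarrow> real^'d \<Rightarrow> real^'m) \<Rightarrow>
   ((real^'d \<Rightarrow> real^'m) \<Rightarrow> (real^'d \<Rightarrow> real^'m) set) \<Rightarrow>
   ((real^'d \<Rightarrow> real^'m) \<Rightarrow> (real^'d \<Rightarrow> real^'m) \<Rightarrow> real^'d \<Rightarrow> real^'m) \<Rightarrow>
   (real^'m, real^'d^'m) density \<Rightarrow> (real^'d \<Rightarrow> (real^'m) \<times> real) set \<Rightarrow> bool" where
  "admissible_space lo hi D L DG G g X \<longleftrightarrow>
     linear_space X \<and>
     (\<forall>\<Psi>\<in>X. periodic lo hi \<Psi> \<and> fst \<circ> \<Psi> \<in> D \<and> opB L \<Psi> \<in> domN lo hi DG G g \<Psi>) \<and>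
     (\<forall>\<Psi>\<in>X. \<forall>\<Psi>'\<in>X. l2_defined (cbox lo hi) \<Psi> (opB L \<Psi>'))"

definition normB ::
  "(real^'d) set \<Rightarrow> ((real^'d \<Rightarrow> real^'m) \<Rightarrow> real^'d \<Rightarrow> real^'m) \<Rightarrow>
   (real^'d \<Rightarrow> (real^'m) \<times> real) \<Rightarrow> real" where
  "normB \<Omega> L \<Psi> = sqrt (l2_inner \<Omega> \<Psi> (opB L \<Psi>))"

definition eq_energy ::
  "(real^'d) set \<Rightarrow> ((real^'d \<Rightarrow> real^'m) \<Rightarrow> real^'d \<Rightarrow> real^'m) \<Rightarrow> real \<Rightarrow>
   (real^'d \<Rightarrow> (real^'m) \<times> real) \<Rightarrow> real" where
  "eq_energy \<Omega> L A \<Psi> = 1 / 2 * (normB \<Omega> L \<Psi>)\<^sup>2 - A"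


section \<open>Gaussian collocation\<close>

definition shifted_legendre :: "nat \<Rightarrow> real poly" where
  "shifted_legendre s = (pderiv ^^ s) ([:0, 1:] ^ s * [:-1, 1:] ^ s)"

definition gauss_nodes :: "nat \<Rightarrow> (nat \<Rightarrow> real) \<Rightarrow> bool" where
  "gauss_nodes s c \<longleftrightarrow> bij_betw c {1..s} {x. poly (shifted_legendre s) x = 0}"

text \<open>Interpolatory weights: integrals over \<open>[0,1]\<close> of the Lagrange basis at the nodes.\<close>

definition quadrature_weight :: "nat \<Rightarrow> (nat \<Rightarrow> real) \<Rightarrow> nat \<Rightarrow> real" where
  "quadrature_weight s c i =
     integral {0..1} (\<lambda>x. \<Prod>j\<in>{1..s} - {i}. (x - c j) / (c i - c j))"

definition time_polynomial :: "nat \<Rightarrow> ('a \<Rightarrow> 'b::real_vector) set \<Rightarrow> (real \<Rightarrow> 'a \<Rightarrow> 'b) \<Rightarrow> bool" where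
  "time_polynomial s X u \<longleftrightarrow>
     (\<exists>coef. (\<forall>k\<le>s. coef k \<in> X) \<and> (\<forall>t x. u t x = (\<Sum>k\<le>s. t ^ k *\<^sub>R coef k x)))"

text \<open>
  The time derivative of a time polynomial is taken pointwise in \<open>x\<close>, which agrees with
  differentiating the polynomial formally.
\<close>

definition collocation_polynomial ::
  "nat \<Rightarrow> (nat \<Rightarrow> real) \<Rightarrow> real \<Rightarrow> real \<Rightarrow> ('a \<Rightarrow> 'b::real_normed_vector) set \<Rightarrow>
   (('a \<Rightarrow> 'b) \<Rightarrow> 'a \<Rightarrow> 'b) \<Rightarrow> ('a \<Rightarrow> 'b) \<Rightarrow> (real \<Rightarrow> 'a \<Rightarrow> 'b) \<Rightarrow> bool" where
  "collocation_polynomial s c t\<^sub>0 h X rhs \<Psi>\<^sub>0 u \<longleftrightarrow>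
     time_polynomial s X u \<and>
     u t\<^sub>0 = \<Psi>\<^sub>0 \<and>
     (\<forall>i\<in>{1..s}. \<forall>x. ((\<lambda>t. u t x) has_vector_derivative rhs (u (t\<^sub>0 + c i * h)) x)
                        (at (t\<^sub>0 + c i * h)))"

end

theory Submission
  imports Defs
begin

text \<open>
  Along the collocation polynomial \<open>u\<close>, of degree at most \<open>s\<close> in time, the energy
  \<open>E(t) = 1/2 (u(t), \<B> u(t)) - A\<close> is a polynomial of degree at most \<open>2 * s\<close>, because \<open>\<B>\<close> is linear and
  independent of the state. Since \<open>\<B>\<close> is self-adjoint, its derivative is \<open>E'(t) = (\<B> u(t), u'(t))\<close>,
  of degree at most \<open>2 * s - 1\<close>. The \<open>s\<close>-point Gauss rule integrates such a polynomial exactly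
  (\<open>gauss_quadrature_exact\<close>), so the energy increment over a step is the weighted sum of the values of
  \<open>E'\<close> at the nodes. At the nodes, the only times that enter, the collocation condition allows \<open>u'\<close> to be
  replaced by \<open>\<N>(u) \<B> u\<close>, which gives the energy identity.

  The sign of the right-hand side has two sources. The Gauss weights are nonnegative
  (\<open>gauss_weight_nonneg\<close>). Moreover \<open>(v, \<N>(\<Psi>) v) = (\<A> v, \<G> \<A> v) \<le> 0\<close>, because \<open>\<A>\<^sup>*\<close> really is the
  adjoint of \<open>\<A>\<close> (\<open>opA_adjoint\<close>). When \<open>g\<close> depends on \<open>\<nabla>\<Phi>\<close> this is an integration by parts whose
  boundary terms cancel by periodicity; it rests on the fact that a partial derivative of a periodic
  function has integral zero over a period cell (\<open>integral_periodic_derivative_eq_0\<close>).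
\<close>

section \<open>Gauss--Legendre quadrature\<close>

lemma poly_integrable: "poly p integrable_on {a..b::real}"
  by (intro integrable_continuous_real continuous_on_poly continuous_on_id)

lemma integral_poly_pderiv:
  fixes p :: "real poly"
  assumes "a \<le> b"
  shows "integral {a..b} (poly (pderiv p)) = poly p b - poly p a"
proof (rule integral_unique, rule fundamental_theorem_of_calculus[OF assms])
  fix x assume "x \<in> {a..b}"
  show "(poly p has_vector_derivative poly (pderiv p) x) (at x within {a..b})"
    using poly_DERIV[of p x]
    by (simp add: has_field_derivative_at_within has_real_derivative_iff_has_vector_derivative[symmetric])
qed

lemma integral_poly_add:
  fixes p q :: "real poly"
  shows "integral {a..b} (poly (p + q)) = integral {a..b} (poly p) + integral {a..b} (poly q)"
  using integral_add[OF poly_integrable poly_integrable, of a b p q]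
  by (simp add: poly_add[abs_def])

text \<open>
  A root of multiplicity at least \<open>k + 1\<close> is a root of multiplicity at least \<open>k\<close> of the
  derivative. A general \<open>z\<close> lets the two end points of an interval be treated together.
\<close>
lemma power_Suc_dvd_imp_power_dvd_pderiv:
  fixes z p :: "'a::idom poly"
  assumes "z ^ Suc k dvd p"
  shows "z ^ k dvd pderiv p"
proof -
  obtain r where "p = z ^ Suc k * r"
    using assms by (elim dvdE)
  then have "pderiv p = z ^ k * (z * pderiv r + smult (of_nat (Suc k)) (pderiv z) * r)"
    by (simp add: pderiv_mult pderiv_power_Suc algebra_simps del: power_Suc)
       (simp add: algebra_simps)
  then show ?thesis
    by simp
qed

lemma power_dvd_imp_power_dvd_funpow_pderiv:
  fixes z p :: "'a::idom poly"
  assumes "z ^ (n + k) dvd p"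
  shows "z ^ k dvd (pderiv ^^ n) p"
  using assms
proof (induction n arbitrary: k)
  case (Suc n)
  then have "z ^ (n + Suc k) dvd p"
    by simp
  then have "z ^ Suc k dvd (pderiv ^^ n) p"
    by (rule Suc.IH)
  then show ?case
    using power_Suc_dvd_imp_power_dvd_pderiv by simp
qed simp

text \<open>
  The orthogonality behind Rodrigues' formula. Integrating by parts \<open>n\<close> times moves all derivatives
  from \<open>w\<close> to \<open>q\<close>. The boundary terms vanish because fewer than \<open>n\<close> derivatives of \<open>w\<close> leave at
  least one factor \<open>z\<close>, which is zero at both ends.
\<close>
lemma integral_funpow_pderiv_mult_eq_0:
  fixes w q z :: "real poly"
  assumes ab: "a \<le> b" and z: "poly z a = 0" "poly z b = 0"
    and w: "z ^ n dvd w" and q: "(pderiv ^^ n) q = 0"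
  shows "integral {a..b} (poly ((pderiv ^^ n) w * q)) = 0"
  using w q
proof (induction n arbitrary: w q)
  case (Suc n)
  define v where "v = (pderiv ^^ n) w"
  have "z ^ 1 dvd v"
    unfolding v_def by (rule power_dvd_imp_power_dvd_funpow_pderiv) (use Suc.prems in simp)
  then have v: "poly v a = 0" "poly v b = 0"
    using z by (auto elim!: dvdE)
  have "z ^ n dvd w"
    using Suc.prems(1) by (metis power_Suc dvd_mult_right)
  moreover have "(pderiv ^^ n) (pderiv q) = 0"
    using Suc.prems(2) by (simp only: funpow_Suc_right o_apply)
  ultimately have "integral {a..b} (poly (v * pderiv q)) = 0"
    unfolding v_def by (rule Suc.IH)
  moreover have "integral {a..b} (poly (pderiv (v * q))) = 0"
    using integral_poly_pderiv[OF ab, of "v * q"] v by simp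
  moreover have "pderiv (v * q) = v * pderiv q + pderiv v * q"
    by (simp add: pderiv_mult algebra_simps)
  ultimately have "integral {a..b} (poly (pderiv v * q)) = 0"
    by (simp only: integral_poly_add)
  then show ?case
    by (simp only: v_def funpow.simps o_apply)
qed (simp add: poly_0[abs_def])

lemma degree_funpow_pderiv:
  fixes p :: "'a::{comm_semiring_1,semiring_no_zero_divisors,semiring_char_0} poly"
  shows "degree ((pderiv ^^ n) p) = degree p - n"
  by (induction n) (simp_all add: degree_pderiv)

lemma funpow_pderiv_eq_0:
  fixes p :: "real poly"
  assumes "degree p < n"
  shows "(pderiv ^^ n) p = 0"
proof -
  from assms obtain m where n: "n = Suc m" "degree p \<le> m"
    by (cases n) auto
  then have "degree ((pderiv ^^ m) p) = 0"
    by (simp add: degree_funpow_pderiv)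
  then show ?thesis
    using n by (simp add: pderiv_eq_0_iff)
qed

lemma degree_shifted_legendre: "degree (shifted_legendre s) = s"
  by (simp add: shifted_legendre_def degree_funpow_pderiv degree_mult_eq degree_power_eq)

lemma shifted_legendre_nonzero:
  assumes "s \<ge> 1"
  shows "shifted_legendre s \<noteq> 0"
  using assms degree_shifted_legendre[of s] by auto

lemma shifted_legendre_orthogonal:
  assumes "degree q < s"
  shows "integral {0..1} (poly (shifted_legendre s * q)) = 0"
proof -
  have "([:0, 1:] * [:-1, 1:] :: real poly) ^ s dvd [:0, 1:] ^ s * [:-1, 1:] ^ s"
    by (metis power_mult_distrib dvd_refl)
  then show ?thesis
    unfolding shifted_legendre_def
    by (intro integral_funpow_pderiv_mult_eq_0[where z = "[:0, 1:] * [:-1, 1:]"]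
          funpow_pderiv_eq_0 assms) simp_all
qed

definition lagrange_basis :: "nat set \<Rightarrow> (nat \<Rightarrow> real) \<Rightarrow> nat \<Rightarrow> real poly" where
  "lagrange_basis J c i = (\<Prod>j\<in>J - {i}. smult (1 / (c i - c j)) [:- c j, 1:])"

lemma poly_lagrange_basis:
  "poly (lagrange_basis J c i) x = (\<Prod>j\<in>J - {i}. (x - c j) / (c i - c j))"
  by (simp add: lagrange_basis_def poly_prod diff_divide_distrib)

lemma degree_lagrange_basis:
  assumes "finite J" "i \<in> J"
  shows "degree (lagrange_basis J c i) < card J"
proof -
  have "degree (lagrange_basis J c i) \<le> (\<Sum>j\<in>J - {i}. degree (smult (1 / (c i - c j)) [:- c j, 1:]))"
    unfolding lagrange_basis_def
    using degree_prod_sum_le[of "J - {i}" "\<lambda>j. smult (1 / (c i - c j)) [:- c j, 1:]"] assms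
    by (simp add: o_def)
  also have "\<dots> \<le> (\<Sum>j\<in>J - {i}. 1)"
    by (intro sum_mono) simp
  also have "\<dots> < card J"
    using card_Diff1_less[OF assms] by simp
  finally show ?thesis .
qed

lemma poly_lagrange_basis_node:
  assumes "finite J" "inj_on c J" "i \<in> J" "k \<in> J"
  shows "poly (lagrange_basis J c i) (c k) = (if k = i then 1 else 0)"
proof (cases "k = i")
  case True
  then show ?thesis
    using assms by (auto simp: poly_lagrange_basis inj_on_eq_iff intro!: prod.neutral)
next
  case False
  then show ?thesis
    using assms by (auto simp: poly_lagrange_basis)
qed

lemma quadrature_weight_eq:
  "quadrature_weight s c i = integral {0..1} (poly (lagrange_basis {1..s} c i))"
  by (simp add: quadrature_weight_def poly_lagrange_basis[abs_def])

text \<open>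
  A polynomial of degree below \<open>s\<close> coincides with its Lagrange interpolant at the \<open>s\<close> distinct
  nodes, and the weights are the integrals of the Lagrange basis.
\<close>
lemma interpolatory_quadrature_exact:
  assumes inj: "inj_on c {1..s}" and deg: "degree p < s"
  shows "integral {0..1} (poly p) = (\<Sum>i=1..s. quadrature_weight s c i * poly p (c i))"
proof -
  let ?l = "lagrange_basis {1..s} c"
  have "p = (\<Sum>i=1..s. smult (poly p (c i)) (?l i))"
  proof (rule poly_eqI_degree[where A = "c ` {1..s}"])
    fix x assume "x \<in> c ` {1..s}"
    then obtain k where k: "k \<in> {1..s}" "x = c k" by auto
    have "poly (\<Sum>i=1..s. smult (poly p (c i)) (?l i)) (c k) =
        (\<Sum>i=1..s. poly p (c i) * (if k = i then 1 else 0))"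
      unfolding poly_sum poly_smult
      using k inj by (intro sum.cong refl) (simp only: poly_lagrange_basis_node finite_atLeastAtMost)
    also have "\<dots> = poly p (c k)"
      using k by (simp add: if_distrib[of "\<lambda>y. _ * y"] cong: if_cong)
    finally show "poly p x = poly (\<Sum>i=1..s. smult (poly p (c i)) (?l i)) x"
      using k by simp
  next
    show "degree p < card (c ` {1..s})"
      using inj deg by (simp add: card_image)
    have "degree (\<Sum>i=1..s. smult (poly p (c i)) (?l i)) < s"
    proof (rule degree_sum_less)
      fix i assume "i \<in> {1..s}"
      then show "degree (smult (poly p (c i)) (?l i)) < s"
        using degree_lagrange_basis[of "{1..s}" i c] degree_smult_le[of "poly p (c i)" "?l i"] by simp
    qed (use deg in simp)
    then show "degree (\<Sum>i=1..s. smult (poly p (c i)) (?l i)) < card (c ` {1..s})"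
      using inj by (simp add: card_image)
  qed
  then have "poly p = (\<lambda>x. \<Sum>i=1..s. poly p (c i) * poly (?l i) x)"
    unfolding poly_smult[symmetric] poly_sum[symmetric] by (rule arg_cong)
  then have "integral {0..1} (poly p) = integral {0..1} (\<lambda>x. \<Sum>i=1..s. poly p (c i) * poly (?l i) x)"
    by (rule arg_cong)
  also have "\<dots> = (\<Sum>i=1..s. integral {0..1} (\<lambda>x. poly p (c i) * poly (?l i) x))"
    by (intro integral_sum) (auto intro!: integrable_on_mult_right poly_integrable)
  also have "\<dots> = (\<Sum>i=1..s. quadrature_weight s c i * poly p (c i))"
    by (simp add: quadrature_weight_eq mult.commute)
  finally show ?thesis .
qed

text \<open>
  Gaussian nodes double the order of exactness. Divide \<open>p\<close> by the Legendre polynomial: the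
  multiple of the Legendre polynomial has integral zero, since the quotient has degree below \<open>s\<close>, and
  it vanishes at every node, so both sides only see the remainder, of degree below \<open>s\<close>.
\<close>
lemma gauss_quadrature_exact:
  assumes c: "gauss_nodes s c" and deg: "degree p < 2 * s"
  shows "integral {0..1} (poly p) = (\<Sum>i=1..s. quadrature_weight s c i * poly p (c i))"
proof -
  let ?P = "shifted_legendre s"
  have s: "s \<ge> 1"
    using deg by simp
  have inj: "inj_on c {1..s}" and root: "\<And>i. i \<in> {1..s} \<Longrightarrow> poly ?P (c i) = 0"
    using c by (auto simp: gauss_nodes_def bij_betw_def)
  define q r where "q = p div ?P" and "r = p mod ?P"
  have p: "p = ?P * q + r"
    by (simp add: q_def r_def)
  have r: "degree r < s"
    using degree_mod_less[OF shifted_legendre_nonzero[OF s], of p] s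
    by (auto simp: r_def degree_shifted_legendre)
  have q: "degree q < s"
  proof (cases "q = 0")
    case False
    have "degree (?P * q) < 2 * s"
      using degree_diff_less[of p "2 * s" r] deg r p by (simp add: algebra_simps)
    then show ?thesis
      using False shifted_legendre_nonzero[OF s] by (simp add: degree_mult_eq degree_shifted_legendre)
  qed (use s in simp)
  have "integral {0..1} (poly p) = integral {0..1} (poly r)"
    by (simp only: p integral_poly_add shifted_legendre_orthogonal[OF q])
  also have "\<dots> = (\<Sum>i=1..s. quadrature_weight s c i * poly r (c i))"
    by (rule interpolatory_quadrature_exact[OF inj r])
  also have "\<dots> = (\<Sum>i=1..s. quadrature_weight s c i * poly p (c i))"
    by (intro sum.cong refl) (simp add: p root)
  finally show ?thesis .
qed

text \<open>
  The rule is exact for the square of a Lagrange basis polynomial, of degree \<open>2 * s - 2\<close>; applied to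
  this square it returns the single weight, while the integral is nonnegative.
\<close>
lemma gauss_weight_nonneg:
  assumes c: "gauss_nodes s c" and i: "i \<in> {1..s}"
  shows "quadrature_weight s c i \<ge> 0"
proof -
  let ?l = "lagrange_basis {1..s} c i"
  have inj: "inj_on c {1..s}"
    using c by (auto simp: gauss_nodes_def bij_betw_def)
  have "degree (?l * ?l) < 2 * s"
    using degree_mult_le[of ?l ?l] degree_lagrange_basis[of "{1..s}" i c] i by simp
  then have "integral {0..1} (poly (?l * ?l)) =
      (\<Sum>k=1..s. quadrature_weight s c k * poly (?l * ?l) (c k))"
    by (rule gauss_quadrature_exact[OF c])
  also have "\<dots> = (\<Sum>k=1..s. if k = i then quadrature_weight s c k else 0)"
    using i inj by (intro sum.cong refl) (simp add: poly_lagrange_basis_node)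
  also have "\<dots> = quadrature_weight s c i"
    using i by simp
  finally show ?thesis
    using integral_nonneg[OF poly_integrable, of 0 1 "?l * ?l"] by simp
qed

section \<open>Integration over a period cell\<close>

lemma integral_cbox_periodic_shift:
  fixes h :: "'a::euclidean_space \<Rightarrow> real"
  assumes cont: "continuous_on UNIV h" and e: "e \<in> Basis"
    and per: "\<And>x. h (x + (b \<bullet> e - a \<bullet> e) *\<^sub>R e) = h x"
    and t: "0 \<le> t" "t \<le> b \<bullet> e - a \<bullet> e"
  shows "integral (cbox a b) (\<lambda>x. h (x + t *\<^sub>R e)) = integral (cbox a b) h"
proof -
  define P where "P = b \<bullet> e - a \<bullet> e"
  define B where "B = cbox a (b + t *\<^sub>R e)"
  have int: "h integrable_on cbox x y" for x y
    by (intro integrable_continuous continuous_on_subset[OF cont]) simp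
  have comp: "(x + r *\<^sub>R e) \<bullet> i = x \<bullet> i + (if i = e then r else 0)" if "i \<in> Basis" for x r i
    using that e by (simp add: inner_add_left inner_Basis)
  have shift: "integral (cbox x y) (\<lambda>z. h (z + r *\<^sub>R e)) = integral (cbox (x + r *\<^sub>R e) (y + r *\<^sub>R e)) h"
    for x y r
    using integral_shift_cbox_plus[of x y h "r *\<^sub>R e"] by (simp add: o_def add.commute)
  have all_e: "(\<forall>i\<in>Basis. Q i) \<longleftrightarrow> Q e \<and> (\<forall>i\<in>Basis - {e}. Q i)" for Q
    using e by auto
  have mem: "x \<in> cbox (a + r *\<^sub>R e) (b + r' *\<^sub>R e) \<longleftrightarrow>
      a \<bullet> e + r \<le> x \<bullet> e \<and> x \<bullet> e \<le> b \<bullet> e + r' \<and> (\<forall>i\<in>Basis - {e}. a \<bullet> i \<le> x \<bullet> i \<and> x \<bullet> i \<le> b \<bullet> i)"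
    for x r r'
    by (subst mem_box, subst all_e) (auto simp: comp e)
  note mem0 = mem[where r = 0, simplified] mem[where r' = 0, simplified]
    mem[where r = 0 and r' = 0, simplified]
  \<comment> \<open>The cell enlarged by \<open>t\<close> is cut once into the shifted cell and a slab, once into the cell
    and the translate of that slab by one period.\<close>
  have "B \<inter> {x. x \<bullet> e \<le> a \<bullet> e + t} = cbox a (b + (t - P) *\<^sub>R e)"
    "B \<inter> {x. x \<bullet> e \<ge> a \<bullet> e + t} = cbox (a + t *\<^sub>R e) (b + t *\<^sub>R e)"
    using t by (auto simp: B_def P_def mem mem0)
  then have 1: "integral B h = integral (cbox a (b + (t - P) *\<^sub>R e)) h
      + integral (cbox (a + t *\<^sub>R e) (b + t *\<^sub>R e)) h"
    using integral_split[OF int e, of a "b + t *\<^sub>R e" "a \<bullet> e + t"] by (simp add: B_def)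
  have "B \<inter> {x. x \<bullet> e \<le> b \<bullet> e} = cbox a b"
    "B \<inter> {x. x \<bullet> e \<ge> b \<bullet> e} = cbox (a + P *\<^sub>R e) (b + t *\<^sub>R e)"
    using t by (auto simp: B_def P_def mem mem0)
  then have 2: "integral B h = integral (cbox a b) h + integral (cbox (a + P *\<^sub>R e) (b + t *\<^sub>R e)) h"
    using integral_split[OF int e, of a "b + t *\<^sub>R e" "b \<bullet> e"] by (simp add: B_def)
  have "integral (cbox (a + P *\<^sub>R e) (b + t *\<^sub>R e)) h = integral (cbox a (b + (t - P) *\<^sub>R e)) h"
    using shift[of a "b + (t - P) *\<^sub>R e" P] per by (simp add: P_def algebra_simps)
  with 1 2 shift[of a b t] show ?thesis
    by simp
qed

text \<open>
  The integral of \<open>h\<close> over the cell shifted by \<open>t\<close> along \<open>e\<close> is independent of \<open>t\<close>; the integral of the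
  partial derivative is its derivative at \<open>t = 0\<close>, hence zero.
\<close>
lemma integral_periodic_derivative_eq_0:
  fixes h :: "'a::euclidean_space \<Rightarrow> real"
  assumes der: "\<And>x. (h has_derivative h' x) (at x)"
    and cont: "continuous_on UNIV (\<lambda>x. h' x e)"
    and e: "e \<in> Basis" and ab: "a \<bullet> e < b \<bullet> e"
    and per: "\<And>x. h (x + (b \<bullet> e - a \<bullet> e) *\<^sub>R e) = h x"
  shows "integral (cbox a b) (\<lambda>x. h' x e) = 0"
proof -
  define P where "P = b \<bullet> e - a \<bullet> e"
  have P: "0 < P"
    using ab by (simp add: P_def)
  have h: "continuous_on UNIV h"
    using der by (meson continuous_at_imp_continuous_on has_derivative_continuous)
  have "((\<lambda>t. integral (cbox a b) (\<lambda>x. h (x + t *\<^sub>R e))) has_vector_derivative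
      integral (cbox a b) (\<lambda>x. h' (x + 0 *\<^sub>R e) e)) (at 0 within {0..P})"
  proof (rule leibniz_rule_vector_derivative)
    fix t x
    have "((\<lambda>t. h (x + t *\<^sub>R e)) has_derivative (\<lambda>r. h' (x + t *\<^sub>R e) (r *\<^sub>R e))) (at t within {0..P})"
      by (rule has_derivative_compose[OF _ der]) (auto intro!: derivative_eq_intros)
    then show "((\<lambda>t. h (x + t *\<^sub>R e)) has_vector_derivative h' (x + t *\<^sub>R e) e) (at t within {0..P})"
      using linear_cmul[OF has_derivative_linear[OF der]] by (simp add: has_vector_derivative_def)
  next
    fix t show "(\<lambda>x. h (x + t *\<^sub>R e)) integrable_on cbox a b"
      by (intro integrable_continuous continuous_on_compose2[OF h]) (auto intro!: continuous_intros)
  next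
    show "continuous_on ({0..P} \<times> cbox a b) (\<lambda>(t, x). h' (x + t *\<^sub>R e) e)"
      unfolding split_beta
      by (intro continuous_on_compose2[OF cont]) (auto intro!: continuous_intros)
  qed (use P in auto)
  moreover have "((\<lambda>t. integral (cbox a b) (\<lambda>x. h (x + t *\<^sub>R e))) has_vector_derivative 0)
      (at 0 within {0..P})"
  proof (rule has_vector_derivative_transform[OF _ _ has_vector_derivative_const])
    fix t assume "t \<in> {0..P}"
    then show "integral (cbox a b) (\<lambda>x. h (x + t *\<^sub>R e)) = integral (cbox a b) h"
      by (intro integral_cbox_periodic_shift h e per) (auto simp: P_def)
  qed (use P in auto)
  ultimately show ?thesis
    using vector_derivative_unique_within_closed_interval[of 0 P 0] P by fastforce
qed

section \<open>The \<open>L\<^sup>2\<close> pairing\<close>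

lemma set_integral_finite_sum:
  fixes f :: "'i \<Rightarrow> 'a \<Rightarrow> 'b::{banach, second_countable_topology}"
  assumes "\<And>i. i \<in> I \<Longrightarrow> set_integrable M A (f i)"
  shows "set_integrable M A (\<lambda>x. \<Sum>i\<in>I. f i x)"
    and "(LINT x:A|M. \<Sum>i\<in>I. f i x) = (\<Sum>i\<in>I. LINT x:A|M. f i x)"
  using assms unfolding set_integrable_def set_lebesgue_integral_def
  by (simp_all add: scaleR_sum_right)

lemma l2_inner_commute: "l2_inner \<Omega> f g = l2_inner \<Omega> g f"
  by (simp add: l2_inner_def mult.commute)

text \<open>
  The pairing is defined componentwise. Once all components are integrable it is the integral of
  the pointwise inner product, so that pointwise identities can be integrated.
\<close>
lemma l2_inner_eq_set_integral:
  assumes "l2_defined \<Omega> f g"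
  shows "set_integrable lebesgue \<Omega> (\<lambda>x. f x \<bullet> g x)"
    and "l2_inner \<Omega> f g = (LINT x:\<Omega>|lebesgue. f x \<bullet> g x)"
  using assms set_integral_finite_sum[of Basis lebesgue \<Omega> "\<lambda>e x. (f x \<bullet> e) * (g x \<bullet> e)"]
  unfolding l2_defined_def l2_inner_def by (simp_all flip: euclidean_inner)

lemma l2_inner_Pair:
  "l2_inner \<Omega> f g = l2_inner \<Omega> (fst \<circ> f) (fst \<circ> g) + l2_inner \<Omega> (snd \<circ> f) (snd \<circ> g)"
proof -
  have "sum h Basis = (\<Sum>e\<in>Basis. h (e, 0)) + (\<Sum>e\<in>Basis. h (0, e))" for h :: "'b \<times> 'c \<Rightarrow> real"
    unfolding Basis_prod_def
    by (subst sum.union_disjoint) (auto simp: sum.reindex inj_on_def)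
  then show ?thesis
    by (simp add: l2_inner_def inner_prod_def)
qed

lemma l2_inner_sum_sum:
  assumes "\<And>i j. i \<in> I \<Longrightarrow> j \<in> J \<Longrightarrow> l2_defined \<Omega> (f i) (g j)"
  shows "l2_inner \<Omega> (\<lambda>x. \<Sum>i\<in>I. p i *\<^sub>R f i x) (\<lambda>x. \<Sum>j\<in>J. q j *\<^sub>R g j x) =
    (\<Sum>i\<in>I. \<Sum>j\<in>J. p i * q j * l2_inner \<Omega> (f i) (g j))"
proof -
  have int: "set_integrable lebesgue \<Omega> (\<lambda>x. p i * q j * ((f i x \<bullet> e) * (g j x \<bullet> e)))"
    if "i \<in> I" "j \<in> J" "e \<in> Basis" for i j e
    using assms that by (auto simp: l2_defined_def)
  have "(LINT x:\<Omega>|lebesgue. ((\<Sum>i\<in>I. p i *\<^sub>R f i x) \<bullet> e) * ((\<Sum>j\<in>J. q j *\<^sub>R g j x) \<bullet> e)) =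
      (\<Sum>i\<in>I. \<Sum>j\<in>J. p i * q j * (LINT x:\<Omega>|lebesgue. (f i x \<bullet> e) * (g j x \<bullet> e)))"
    if e: "e \<in> Basis" for e
  proof -
    have "(LINT x:\<Omega>|lebesgue. ((\<Sum>i\<in>I. p i *\<^sub>R f i x) \<bullet> e) * ((\<Sum>j\<in>J. q j *\<^sub>R g j x) \<bullet> e)) =
        (LINT x:\<Omega>|lebesgue. \<Sum>i\<in>I. \<Sum>j\<in>J. p i * q j * ((f i x \<bullet> e) * (g j x \<bullet> e)))"
      by (simp add: inner_sum_left sum_product mult_ac)
    then show ?thesis
      using e by (simp add: set_integral_finite_sum int)
  qed
  then have "l2_inner \<Omega> (\<lambda>x. \<Sum>i\<in>I. p i *\<^sub>R f i x) (\<lambda>x. \<Sum>j\<in>J. q j *\<^sub>R g j x) =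
      (\<Sum>e\<in>Basis. \<Sum>i\<in>I. \<Sum>j\<in>J. p i * q j * (LINT x:\<Omega>|lebesgue. (f i x \<bullet> e) * (g j x \<bullet> e)))"
    by (simp add: l2_inner_def)
  also have "\<dots> = (\<Sum>i\<in>I. \<Sum>e\<in>Basis. \<Sum>j\<in>J. p i * q j * (LINT x:\<Omega>|lebesgue. (f i x \<bullet> e) * (g j x \<bullet> e)))"
    by (rule sum.swap)
  also have "\<dots> = (\<Sum>i\<in>I. \<Sum>j\<in>J. \<Sum>e\<in>Basis. p i * q j * (LINT x:\<Omega>|lebesgue. (f i x \<bullet> e) * (g j x \<bullet> e)))"
    by (intro sum.cong refl sum.swap)
  finally show ?thesis
    by (simp add: l2_inner_def sum_distrib_left)
qed

lemma linear_space_sum: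
  assumes S: "linear_space S" and f: "\<And>i. i \<in> I \<Longrightarrow> f i \<in> S"
  shows "(\<lambda>x. \<Sum>i\<in>I. a i *\<^sub>R f i x) \<in> S"
  using f
proof (induction I rule: infinite_finite_induct)
  case (insert j I)
  then have "(\<lambda>x. a j *\<^sub>R f j x) \<in> S" "(\<lambda>x. \<Sum>i\<in>I. a i *\<^sub>R f i x) \<in> S"
    using S by (auto simp: linear_space_def)
  then show ?case
    using S insert.hyps by (simp add: linear_space_def)
qed (use S in \<open>simp_all add: linear_space_def\<close>)

lemma linear_operator_on_sum:
  assumes S: "linear_space S" and T: "linear_operator_on S T" and f: "\<And>i. i \<in> I \<Longrightarrow> f i \<in> S"
  shows "T (\<lambda>x. \<Sum>i\<in>I. a i *\<^sub>R f i x) = (\<lambda>x. \<Sum>i\<in>I. a i *\<^sub>R T (f i) x)"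
proof -
  have "(\<lambda>x. 0) \<in> S" "\<And>c g. g \<in> S \<Longrightarrow> T (\<lambda>x. c *\<^sub>R g x) = (\<lambda>x. c *\<^sub>R T g x)"
    using S T by (auto simp: linear_space_def linear_operator_on_def)
  from this(2)[OF this(1), of 0] have T0: "T (\<lambda>x. 0) = (\<lambda>x. 0)"
    by simp
  show ?thesis
    using f
  proof (induction I rule: infinite_finite_induct)
    case (insert j I)
    then have "(\<lambda>x. a j *\<^sub>R f j x) \<in> S" "(\<lambda>x. \<Sum>i\<in>I. a i *\<^sub>R f i x) \<in> S"
      using S linear_space_sum[OF S, of I f a] by (auto simp: linear_space_def)
    then show ?case
      using T insert by (simp add: linear_operator_on_def)
  qed (simp_all add: T0)
qed

section \<open>The operator \<open>\<B>\<close>\<close>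

lemma opB_sum:
  assumes "linear_space D" "linear_operator_on D L" "\<And>i. i \<in> I \<Longrightarrow> fst \<circ> f i \<in> D"
  shows "opB L (\<lambda>x. \<Sum>i\<in>I. a i *\<^sub>R f i x) = (\<lambda>x. \<Sum>i\<in>I. a i *\<^sub>R opB L (f i) x)"
proof -
  have "fst \<circ> (\<lambda>x. \<Sum>i\<in>I. a i *\<^sub>R f i x) = (\<lambda>x. \<Sum>i\<in>I. a i *\<^sub>R (fst \<circ> f i) x)"
    by (simp add: fun_eq_iff fst_sum)
  then show ?thesis
    using linear_operator_on_sum[OF assms(1,2), of I "\<lambda>i. fst \<circ> f i" a] assms(3)
    by (intro ext) (simp add: opB_def prod_eq_iff fst_sum snd_sum)
qed

lemma opB_components: "fst \<circ> opB L \<Psi> = L (fst \<circ> \<Psi>)" "snd \<circ> opB L \<Psi> = snd \<circ> \<Psi>"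
  by (auto simp: opB_def)

lemma opB_symmetric:
  assumes "self_adjoint_on \<Omega> D L" "fst \<circ> \<Psi> \<in> D" "fst \<circ> \<Psi>' \<in> D"
  shows "l2_inner \<Omega> \<Psi> (opB L \<Psi>') = l2_inner \<Omega> \<Psi>' (opB L \<Psi>)"
proof -
  have "l2_inner \<Omega> (fst \<circ> \<Psi>) (L (fst \<circ> \<Psi>')) = l2_inner \<Omega> (L (fst \<circ> \<Psi>)) (fst \<circ> \<Psi>')"
    using assms unfolding self_adjoint_on_def by blast
  then show ?thesis
    unfolding l2_inner_Pair[of \<Omega> \<Psi>] l2_inner_Pair[of \<Omega> \<Psi>'] opB_components
    by (simp add: l2_inner_commute)
qed

text \<open>
  Needed to undo the square root in the \<open>\<B>\<close>-norm. Positive definiteness of \<open>L\<close> speaks only of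
  functions that do not vanish almost everywhere, so the other case is treated separately; in it
  the integrand is zero almost everywhere.
\<close>
lemma l2_inner_opB_nonneg:
  assumes "positive_definite_on \<Omega> D L" "fst \<circ> \<Psi> \<in> D"
  shows "0 \<le> l2_inner \<Omega> \<Psi> (opB L \<Psi>)"
proof -
  have "0 \<le> l2_inner \<Omega> (fst \<circ> \<Psi>) (L (fst \<circ> \<Psi>))"
  proof (cases "AE x in lebesgue. x \<in> \<Omega> \<longrightarrow> (fst \<circ> \<Psi>) x = 0")
    case True
    have "(LINT x:\<Omega>|lebesgue. ((fst \<circ> \<Psi>) x \<bullet> e) * (L (fst \<circ> \<Psi>) x \<bullet> e)) = 0" for e
      unfolding set_lebesgue_integral_def
      by (rule integral_eq_zero_AE, use True in eventually_elim) (auto simp: indicator_def)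
    then show ?thesis
      by (simp add: l2_inner_def)
  next
    case False
    then show ?thesis
      using assms unfolding positive_definite_on_def by (blast intro: less_imp_le)
  qed
  moreover have "0 \<le> l2_inner \<Omega> (snd \<circ> \<Psi>) (snd \<circ> \<Psi>)"
    unfolding l2_inner_def set_lebesgue_integral_def by (intro sum_nonneg Bochner_Integration.integral_nonneg) simp
  ultimately show ?thesis
    by (simp add: l2_inner_Pair[of \<Omega> \<Psi>] opB_components)
qed

lemma eq_energy_eq:
  assumes "positive_definite_on \<Omega> D L" "fst \<circ> \<Psi> \<in> D"
  shows "eq_energy \<Omega> L A \<Psi> = 1 / 2 * l2_inner \<Omega> \<Psi> (opB L \<Psi>) - A"
  using l2_inner_opB_nonneg[OF assms] by (simp add: eq_energy_def normB_def)

section \<open>The operator \<open>\<N>(\<Psi>)\<close>\<close>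

lemma frechet_derivative_periodic:
  fixes f :: "'a::real_normed_vector \<Rightarrow> 'b::real_normed_vector"
  assumes "\<And>x. f (x + p) = f x" "f differentiable (at (x + p))"
  shows "frechet_derivative f (at (x + p)) = frechet_derivative f (at x)"
proof (rule frechet_derivative_at)
  have "((\<lambda>y. f (y + p)) has_derivative (\<lambda>v. frechet_derivative f (at (x + p)) v)) (at x)"
    by (rule has_derivative_compose[where g = f])
       (use assms(2) in \<open>auto intro!: derivative_eq_intros simp: frechet_derivative_works\<close>)
  then show "(f has_derivative frechet_derivative f (at (x + p))) (at x)"
    using assms(1) by simp
qed

lemma flux_periodic:
  assumes "periodic lo hi \<Phi>" "periodic lo hi r" "\<And>x. \<Phi> differentiable (at x)"
  shows "periodic lo hi (flux g \<Phi> r)"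
  using assms unfolding periodic_def
  by (auto simp: flux_def jacobian_def frechet_derivative_periodic)

text \<open>
  Integration by parts on the torus. The integrand is the divergence of the vector field with
  components \<open>\<Sum>k. M $ k $ j * \<Theta> $ k\<close>, and each of its partial derivatives integrates to zero over a
  period cell.
\<close>
lemma integral_divergence_product_rule:
  fixes M :: "real^'d \<Rightarrow> real^'d^'m" and \<Theta> :: "real^'d \<Rightarrow> real^'m"
  assumes box: "\<forall>i. lo $ i < hi $ i"
    and M: "continuously_differentiable M" "periodic lo hi M"
    and \<Theta>: "continuously_differentiable \<Theta>" "periodic lo hi \<Theta>"
  shows "set_integrable lebesgue (cbox lo hi) (\<lambda>x. M x \<bullet> jacobian \<Theta> (at x) + divergence M x \<bullet> \<Theta> x)"
    and "(LINT x:cbox lo hi|lebesgue. M x \<bullet> jacobian \<Theta> (at x) + divergence M x \<bullet> \<Theta> x) = 0"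
proof -
  define M' where "M' x = frechet_derivative M (at x)" for x
  define \<Theta>' where "\<Theta>' x = frechet_derivative \<Theta> (at x)" for x
  define h where "h j x = (\<Sum>k\<in>UNIV. M x $ k $ j * \<Theta> x $ k)" for j x
  define h' where "h' j x v = (\<Sum>k\<in>UNIV. M x $ k $ j * \<Theta>' x v $ k + M' x v $ k $ j * \<Theta> x $ k)" for j x v
  have dM: "(M has_derivative M' x) (at x)" and d\<Theta>: "(\<Theta> has_derivative \<Theta>' x) (at x)" for x
    using M(1) \<Theta>(1)
    by (auto simp: continuously_differentiable_def M'_def \<Theta>'_def simp flip: frechet_derivative_works)
  have cM: "continuous_on UNIV M" and c\<Theta>: "continuous_on UNIV \<Theta>"
    using dM d\<Theta> by (meson continuous_at_imp_continuous_on has_derivative_continuous)+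
  have cM': "continuous_on UNIV (\<lambda>x. M' x v)" and c\<Theta>': "continuous_on UNIV (\<lambda>x. \<Theta>' x v)" for v
    using M(1) \<Theta>(1) by (auto simp: continuously_differentiable_def M'_def \<Theta>'_def)
  have dh: "(h j has_derivative h' j x) (at x)" for j x
  proof -
    have "((\<lambda>x. M x $ k $ j) has_derivative (\<lambda>v. M' x v $ k $ j)) (at x)"
      "((\<lambda>x. \<Theta> x $ k) has_derivative (\<lambda>v. \<Theta>' x v $ k)) (at x)" for k
      by (intro bounded_linear.has_derivative[OF bounded_linear_vec_nth] dM d\<Theta>)+
    then show ?thesis
      unfolding h_def[abs_def] h'_def[abs_def]
      by (intro has_derivative_sum has_derivative_mult)
  qed
  have ch': "continuous_on UNIV (\<lambda>x. h' j x (axis j 1))" for j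
    unfolding h'_def by (intro continuous_intros cM c\<Theta> cM' c\<Theta>')
  have int: "set_integrable lebesgue (cbox lo hi) (\<lambda>x. h' j x (axis j 1))" for j
    by (intro absolutely_integrable_continuous continuous_on_subset[OF ch']) simp
  have zero: "(LINT x:cbox lo hi|lebesgue. h' j x (axis j 1)) = 0" for j
    unfolding set_lebesgue_integral_eq_integral(2)[OF int]
  proof (rule integral_periodic_derivative_eq_0[OF dh ch'])
    show "lo \<bullet> axis j 1 < hi \<bullet> axis j 1"
      using box by (simp add: inner_axis)
    fix x
    have "(hi \<bullet> axis j 1 - lo \<bullet> axis j 1) *\<^sub>R axis j 1 = axis j (hi $ j - lo $ j)"
      by (simp add: inner_axis) (simp add: axis_def vec_eq_iff)
    then show "h j (x + (hi \<bullet> axis j 1 - lo \<bullet> axis j 1) *\<^sub>R axis j 1) = h j x"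
      using M(2) \<Theta>(2) by (simp add: h_def periodic_def)
  qed simp
  have eq: "M x \<bullet> jacobian \<Theta> (at x) + divergence M x \<bullet> \<Theta> x = (\<Sum>j\<in>UNIV. h' j x (axis j 1))" for x
  proof -
    have "M x \<bullet> jacobian \<Theta> (at x) + divergence M x \<bullet> \<Theta> x =
        (\<Sum>k\<in>UNIV. \<Sum>j\<in>UNIV. M x $ k $ j * \<Theta>' x (axis j 1) $ k + M' x (axis j 1) $ k $ j * \<Theta> x $ k)"
      by (simp add: inner_vec_def jacobian_def matrix_def divergence_def M'_def \<Theta>'_def
          sum.distrib sum_distrib_right)
    also have "\<dots> = (\<Sum>j\<in>UNIV. h' j x (axis j 1))"
      unfolding h'_def by (rule sum.swap)
    finally show ?thesis .
  qed
  show "set_integrable lebesgue (cbox lo hi) (\<lambda>x. M x \<bullet> jacobian \<Theta> (at x) + divergence M x \<bullet> \<Theta> x)"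
    "(LINT x:cbox lo hi|lebesgue. M x \<bullet> jacobian \<Theta> (at x) + divergence M x \<bullet> \<Theta> x) = 0"
    unfolding eq using int zero by (simp_all add: set_integral_finite_sum)
qed

text \<open>
  In the gradient-dependent case the two integrands differ exactly by the expression of
  \<open>integral_divergence_product_rule\<close> for the flux \<open>r \<partial>g/\<partial>\<nabla>\<Phi>\<close>; in the other case they are equal.
\<close>
lemma opA_adjoint:
  assumes box: "\<forall>i. lo $ i < hi $ i"
    and per: "periodic lo hi \<Psi>" "periodic lo hi v" "periodic lo hi \<Theta>"
    and reg: "regular_for_A g \<Psi> v" "regular_for_A_adj g \<Theta>"
    and l2: "l2_defined (cbox lo hi) v (opA_adj g \<Psi> \<Theta>)" "l2_defined (cbox lo hi) (opA g \<Psi> v) \<Theta>"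
  shows "l2_inner (cbox lo hi) v (opA_adj g \<Psi> \<Theta>) = l2_inner (cbox lo hi) (opA g \<Psi> v) \<Theta>"
proof (cases g)
  case (Local \<gamma>)
  have "v x \<bullet> opA_adj g \<Psi> \<Theta> x = opA g \<Psi> v x \<bullet> \<Theta> x" for x
    by (simp add: Local inner_prod_def inner_add_left)
  then show ?thesis
    by (simp add: l2_inner_eq_set_integral l2)
next
  case (Gradient \<gamma>)
  define M where "M = flux \<gamma> (fst \<circ> \<Psi>) (snd \<circ> v)"
  have M: "continuously_differentiable M" "periodic lo hi M"
    using reg(1) per(1,2) flux_periodic[of lo hi "fst \<circ> \<Psi>" "snd \<circ> v" \<gamma>]
    by (simp_all add: Gradient M_def periodic_def)
  have \<Theta>: "continuously_differentiable \<Theta>"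
    using reg(2) by (simp add: Gradient)
  note parts = integral_divergence_product_rule[OF box M \<Theta> per(3)]
  have "v x \<bullet> opA_adj g \<Psi> \<Theta> x = opA g \<Psi> v x \<bullet> \<Theta> x
      + (M x \<bullet> jacobian \<Theta> (at x) + divergence M x \<bullet> \<Theta> x)" for x
    by (simp add: Gradient M_def flux_def inner_prod_def inner_add_left inner_diff_left algebra_simps)
  then show ?thesis
    using parts by (simp add: l2_inner_eq_set_integral l2)
qed

text \<open>
  Moving \<open>\<A>\<^sup>*\<close> to the other side of the pairing leaves the form of \<open>\<G>\<close> at \<open>\<A> v\<close>. The domain of
  \<open>\<N>(\<Psi>)\<close> collects the regularity that makes this legitimate.
\<close>
lemma opN_dissipative:
  assumes box: "\<forall>i. lo $ i < hi $ i"
    and \<Psi>: "periodic lo hi \<Psi>"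
    and G: "\<And>\<Theta>. \<Theta> \<in> DG (fst \<circ> \<Psi>) \<Longrightarrow> periodic lo hi (G (fst \<circ> \<Psi>) \<Theta>)"
      "negative_semidefinite_on (cbox lo hi) (DG (fst \<circ> \<Psi>)) (G (fst \<circ> \<Psi>))"
    and v: "v \<in> domN lo hi DG G g \<Psi>"
  shows "l2_inner (cbox lo hi) v (opN G g \<Psi> v) \<le> 0"
proof -
  let ?w = "opA g \<Psi> v"
  have w: "?w \<in> DG (fst \<circ> \<Psi>)"
    using v by (simp add: domN_def)
  then have neg: "l2_defined (cbox lo hi) ?w (G (fst \<circ> \<Psi>) ?w)"
    "l2_inner (cbox lo hi) ?w (G (fst \<circ> \<Psi>) ?w) \<le> 0"
    using G(2) by (auto simp: negative_semidefinite_on_def)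
  have "l2_inner (cbox lo hi) v (opN G g \<Psi> v) = l2_inner (cbox lo hi) ?w (G (fst \<circ> \<Psi>) ?w)"
    using v unfolding domN_def opN_def
    by (intro opA_adjoint[OF box \<Psi> _ G(1)[OF w]] neg) auto
  with neg show ?thesis
    by simp
qed

section \<open>Energy balance of the collocation step\<close>

text \<open>
  The double sum is the value at \<open>t\<close> of a quadratic form on a curve of degree \<open>s\<close>, so it is a
  polynomial in \<open>t\<close> of degree at most \<open>2 * s\<close>. Its derivative has degree at most \<open>2 * s - 1\<close>, and
  integrating it by the Gauss rule with \<open>s\<close> nodes makes no error. Symmetry of the form gives the factor 2.
\<close>
lemma gauss_quadrature_quadratic_form_increment:
  fixes \<alpha> :: "nat \<Rightarrow> nat \<Rightarrow> real"
  assumes c: "gauss_nodes s c" and s: "s \<ge> 1"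
    and sym: "\<And>k l. k \<le> s \<Longrightarrow> l \<le> s \<Longrightarrow> \<alpha> k l = \<alpha> l k"
  shows "(\<Sum>k\<le>s. \<Sum>l\<le>s. (t + h) ^ k * (t + h) ^ l * \<alpha> k l) - (\<Sum>k\<le>s. \<Sum>l\<le>s. t ^ k * t ^ l * \<alpha> k l) =
    2 * (h * (\<Sum>i=1..s. quadrature_weight s c i *
      (\<Sum>k\<le>s. \<Sum>l\<le>s. (of_nat k * (t + c i * h) ^ (k - 1)) * (t + c i * h) ^ l * \<alpha> k l)))"
proof -
  \<comment> \<open>\<open>q\<close> is the form as a function of the rescaled time in the unit interval.\<close>
  define p where "p = (\<Sum>k\<le>s. \<Sum>l\<le>s. monom (\<alpha> k l) (k + l))"
  define q where "q = pcompose p [:t, h:]"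
  have p: "poly p x = (\<Sum>k\<le>s. \<Sum>l\<le>s. x ^ k * x ^ l * \<alpha> k l)" for x
    by (simp add: p_def poly_sum poly_monom power_add mult_ac)
  have p': "poly (pderiv p) x = 2 * (\<Sum>k\<le>s. \<Sum>l\<le>s. (of_nat k * x ^ (k - 1)) * x ^ l * \<alpha> k l)" for x
  proof -
    have mono: "poly (pderiv (monom (\<alpha> k l) (k + l))) x =
        (of_nat k * x ^ (k - 1)) * x ^ l * \<alpha> k l + (of_nat l * x ^ (l - 1)) * x ^ k * \<alpha> k l" for k l
    proof -
      have "monom (\<alpha> k l) (k + l) = smult (\<alpha> k l) (monom 1 k * monom 1 l)"
        by (simp add: mult_monom smult_monom)
      then show ?thesis
        by (simp add: pderiv_smult pderiv_mult pderiv_monom poly_monom algebra_simps)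
    qed
    have "poly (pderiv p) x = (\<Sum>k\<le>s. \<Sum>l\<le>s. (of_nat k * x ^ (k - 1)) * x ^ l * \<alpha> k l)
        + (\<Sum>k\<le>s. \<Sum>l\<le>s. (of_nat l * x ^ (l - 1)) * x ^ k * \<alpha> k l)"
      by (simp add: p_def higher_pderiv_sum[of 1, simplified] poly_sum mono sum.distrib)
    also have "(\<Sum>k\<le>s. \<Sum>l\<le>s. (of_nat l * x ^ (l - 1)) * x ^ k * \<alpha> k l) =
        (\<Sum>l\<le>s. \<Sum>k\<le>s. (of_nat l * x ^ (l - 1)) * x ^ k * \<alpha> l k)"
      by (subst sum.swap) (auto intro!: sum.cong simp: sym)
    finally show ?thesis
      by simp
  qed
  have "degree p \<le> 2 * s"
    unfolding p_def by (intro degree_sum_le) (auto intro!: order.trans[OF degree_monom_le])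
  then have "degree q \<le> 2 * s"
    using degree_pcompose_le[of p "[:t, h:]"] unfolding q_def by (auto split: if_splits)
  then have "degree (pderiv q) < 2 * s"
    using s by (simp add: degree_pderiv)
  then have "(\<Sum>i=1..s. quadrature_weight s c i * poly (pderiv q) (c i)) = poly q 1 - poly q 0"
    using gauss_quadrature_exact[OF c] integral_poly_pderiv[of 0 1 q] by simp
  also have "\<dots> = poly p (t + h) - poly p t"
    by (simp add: q_def poly_pcompose)
  finally have "poly p (t + h) - poly p t =
      (\<Sum>i=1..s. quadrature_weight s c i * (h * poly (pderiv p) (t + c i * h)))"
    by (simp add: q_def pderiv_pcompose poly_pcompose pderiv_pCons mult_ac)
  then show ?thesis
    unfolding p p' by (simp add: sum_distrib_left mult_ac)
qed

theorem theorem3p3: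
  fixes lo hi :: "real^'d"
    and L :: "(real^'d \<Rightarrow> real^'m) \<Rightarrow> real^'d \<Rightarrow> real^'m"
    and D :: "(real^'d \<Rightarrow> real^'m) set"
    and G :: "(real^'d \<Rightarrow> real^'m) \<Rightarrow> (real^'d \<Rightarrow> real^'m) \<Rightarrow> real^'d \<Rightarrow> real^'m"
    and DG :: "(real^'d \<Rightarrow> real^'m) \<Rightarrow> (real^'d \<Rightarrow> real^'m) set"
    and f g :: "(real^'m, real^'d^'m) density"
    and A t\<^sub>n \<Delta>t :: real
    and X :: "(real^'d \<Rightarrow> (real^'m) \<times> real) set"
    and s :: nat and c b :: "nat \<Rightarrow> real"
    and u :: "real \<Rightarrow> real^'d \<Rightarrow> (real^'m) \<times> real"
    and \<Psi>\<^sub>n \<Psi>\<^sub>n\<^sub>1 :: "real^'d \<Rightarrow> (real^'m) \<times> real"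
    and F :: "(real^'d \<Rightarrow> (real^'m) \<times> real) \<Rightarrow> real"
  defines "g \<equiv> eq_density (measure lebesgue (cbox lo hi)) A f"
    and "F \<equiv> eq_energy (cbox lo hi) L A"
  assumes box: "\<forall>i. lo $ i < hi $ i"
    and L: "linear_space D" "\<forall>\<Phi>\<in>D. periodic lo hi \<Phi> \<and> periodic lo hi (L \<Phi>)"
      "linear_operator_on D L" "self_adjoint_on (cbox lo hi) D L"
      "positive_definite_on (cbox lo hi) D L"
    and G: "\<forall>\<Phi>\<in>D. linear_space (DG \<Phi>)"
      "\<forall>\<Phi>\<in>D. \<forall>\<Theta>\<in>DG \<Phi>. periodic lo hi \<Theta> \<and> periodic lo hi (G \<Phi> \<Theta>)"
      "\<forall>\<Phi>\<in>D. linear_operator_on (DG \<Phi>) (G \<Phi>)"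
      "\<forall>\<Phi>\<in>D. negative_semidefinite_on (cbox lo hi) (DG \<Phi>) (G \<Phi>)"
    and f: "bounded_from_below f" "eq_well_defined (measure lebesgue (cbox lo hi)) A f"
    and X: "admissible_space lo hi D L DG G g X"
    and s: "s \<ge> 1"
    and c: "gauss_nodes s c"
    and b: "\<forall>i\<in>{1..s}. b i = quadrature_weight s c i"
    and dt: "\<Delta>t > 0"
    and u: "collocation_polynomial s c t\<^sub>n \<Delta>t X (\<lambda>\<Psi>. opN G g \<Psi> (opB L \<Psi>)) \<Psi>\<^sub>n u"
    and u1: "\<Psi>\<^sub>n\<^sub>1 = u (t\<^sub>n + \<Delta>t)"
  shows "F \<Psi>\<^sub>n\<^sub>1 - F \<Psi>\<^sub>n =
           \<Delta>t * (\<Sum>i=1..s. b i *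
             l2_inner (cbox lo hi) (opB L (u (t\<^sub>n + c i * \<Delta>t)))
               (opN G g (u (t\<^sub>n + c i * \<Delta>t)) (opB L (u (t\<^sub>n + c i * \<Delta>t)))))
         \<and> \<Delta>t * (\<Sum>i=1..s. b i *
             l2_inner (cbox lo hi) (opB L (u (t\<^sub>n + c i * \<Delta>t)))
               (opN G g (u (t\<^sub>n + c i * \<Delta>t)) (opB L (u (t\<^sub>n + c i * \<Delta>t))))) \<le> 0"
proof -
  let ?\<Omega> = "cbox lo hi"
  let ?\<tau> = "\<lambda>i. t\<^sub>n + c i * \<Delta>t"
  have X_lin: "linear_space X"
    and X_mem: "\<And>\<Psi>. \<Psi> \<in> X \<Longrightarrow> periodic lo hi \<Psi> \<and> fst \<circ> \<Psi> \<in> D \<and> opB L \<Psi> \<in> domN lo hi DG G g \<Psi>"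
    and X_l2: "\<And>\<Psi> \<Psi>'. \<Psi> \<in> X \<Longrightarrow> \<Psi>' \<in> X \<Longrightarrow> l2_defined ?\<Omega> \<Psi> (opB L \<Psi>')"
    using X by (auto simp: admissible_space_def)
  obtain coef where coef: "\<And>k. k \<le> s \<Longrightarrow> coef k \<in> X"
    and u_eq: "\<And>t. u t = (\<lambda>x. \<Sum>k\<le>s. t ^ k *\<^sub>R coef k x)"
    using u unfolding collocation_polynomial_def time_polynomial_def fun_eq_iff by blast
  have u0: "u t\<^sub>n = \<Psi>\<^sub>n"
    and u': "\<And>i x. i \<in> {1..s} \<Longrightarrow>
      ((\<lambda>t. u t x) has_vector_derivative opN G g (u (?\<tau> i)) (opB L (u (?\<tau> i))) x) (at (?\<tau> i))"
    using u by (auto simp: collocation_polynomial_def)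
  have u_X: "u t \<in> X" for t
    unfolding u_eq by (rule linear_space_sum[OF X_lin]) (simp add: coef)
  have Bu: "opB L (u t) = (\<lambda>x. \<Sum>k\<le>s. t ^ k *\<^sub>R opB L (coef k) x)" for t
    unfolding u_eq by (rule opB_sum[OF L(1,3)]) (use coef X_mem in auto)
  define \<alpha> where "\<alpha> k l = l2_inner ?\<Omega> (coef k) (opB L (coef l))" for k l
  have sym: "\<alpha> k l = \<alpha> l k" if "k \<le> s" "l \<le> s" for k l
    unfolding \<alpha>_def using that coef X_mem by (intro opB_symmetric[OF L(4)]) auto
  \<comment> \<open>The energy along the whole curve \<open>u\<close> is, up to the constant, half the quadratic form of
    the Gram matrix \<open>\<alpha>\<close>.\<close>
  have F_u: "F (u t) = 1 / 2 * (\<Sum>k\<le>s. \<Sum>l\<le>s. t ^ k * t ^ l * \<alpha> k l) - A" for t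
  proof -
    have "F (u t) = 1 / 2 * l2_inner ?\<Omega> (u t) (opB L (u t)) - A"
      unfolding F_def using X_mem[OF u_X] by (intro eq_energy_eq[OF L(5)]) simp
    also have "l2_inner ?\<Omega> (u t) (opB L (u t)) = (\<Sum>k\<le>s. \<Sum>l\<le>s. t ^ k * t ^ l * \<alpha> k l)"
      unfolding Bu \<alpha>_def unfolding u_eq by (rule l2_inner_sum_sum) (simp add: X_l2 coef)
    finally show ?thesis .
  qed
  \<comment> \<open>At a node the right-hand side of the flow is the formal time derivative of \<open>u\<close>, which lies in
    the span of the coefficients, so the dissipation rate is again expressed through \<open>\<alpha>\<close>.\<close>
  have rate: "l2_inner ?\<Omega> (opB L (u (?\<tau> i))) (opN G g (u (?\<tau> i)) (opB L (u (?\<tau> i)))) =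
      (\<Sum>k\<le>s. \<Sum>l\<le>s. (of_nat k * ?\<tau> i ^ (k - 1)) * ?\<tau> i ^ l * \<alpha> k l)" if i: "i \<in> {1..s}" for i
  proof -
    have N: "opN G g (u (?\<tau> i)) (opB L (u (?\<tau> i))) =
        (\<lambda>x. \<Sum>k\<le>s. (of_nat k * ?\<tau> i ^ (k - 1)) *\<^sub>R coef k x)"
    proof
      fix x
      have "((\<lambda>t. u t x) has_vector_derivative
          (\<Sum>k\<le>s. (of_nat k * ?\<tau> i ^ (k - 1)) *\<^sub>R coef k x)) (at (?\<tau> i))"
        unfolding u_eq
        by (auto intro!: derivative_eq_intros simp: has_vector_derivative_def scaleR_sum_right mult_ac)
      with u'[OF i] show "opN G g (u (?\<tau> i)) (opB L (u (?\<tau> i))) x =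
          (\<Sum>k\<le>s. (of_nat k * ?\<tau> i ^ (k - 1)) *\<^sub>R coef k x)"
        by (rule vector_derivative_unique_at)
    qed
    show ?thesis
      unfolding l2_inner_commute[of ?\<Omega> "opB L (u (?\<tau> i))"] unfolding N unfolding Bu \<alpha>_def
      by (rule l2_inner_sum_sum) (simp add: X_l2 coef)
  qed
  have "F \<Psi>\<^sub>n\<^sub>1 - F \<Psi>\<^sub>n = \<Delta>t * (\<Sum>i=1..s. quadrature_weight s c i *
      (\<Sum>k\<le>s. \<Sum>l\<le>s. (of_nat k * ?\<tau> i ^ (k - 1)) * ?\<tau> i ^ l * \<alpha> k l))"
    using gauss_quadrature_quadratic_form_increment[where \<alpha> = \<alpha> and t = t\<^sub>n and h = \<Delta>t, OF c s sym]
    unfolding u1 u0[symmetric] F_u by linarith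
  also have "\<dots> = \<Delta>t * (\<Sum>i=1..s. b i *
      l2_inner ?\<Omega> (opB L (u (?\<tau> i))) (opN G g (u (?\<tau> i)) (opB L (u (?\<tau> i)))))"
    using b by (auto simp: rate intro!: sum.cong)
  finally have balance: "F \<Psi>\<^sub>n\<^sub>1 - F \<Psi>\<^sub>n = \<dots>" .
  have "l2_inner ?\<Omega> (opB L (u t)) (opN G g (u t) (opB L (u t))) \<le> 0" for t
    using X_mem[OF u_X] G(2,4) by (intro opN_dissipative[OF box, of _ DG]) auto
  then have "\<Delta>t * (\<Sum>i=1..s. b i *
      l2_inner ?\<Omega> (opB L (u (?\<tau> i))) (opN G g (u (?\<tau> i)) (opB L (u (?\<tau> i))))) \<le> 0"
    using dt b gauss_weight_nonneg[OF c]
    by (intro mult_nonneg_nonpos sum_nonpos) auto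
  with balance show ?thesis
    by blast
qed

end
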